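(* Let $X\subseteq\mathbb{R}^n$ be a convex set that is either open in $\mathbb{R}^n$ or a polyhedron. Then every non-trivial, reflexive, mixture-continuous and Archimedean binary relation $\succcurlyeq$ on $X$ that demonstrates convex indifference and has a transitive symmetric part $\sim$ is continuous, complete and transitive.
   Context: A polyhedron is an intersection of finitely many closed half-spaces of $\mathbb{R}^n$. $x\succ y$ iff $x\succcurlyeq y$ and not $y\succcurlyeq x$; $x\sim y$ iff $x\succcurlyeq y$ and $y\succcurlyeq x$. For $\lambda\in[0,1]$, $x\lambda y=\lambda x+(1-\lambda)y$. Non-trivial: there exist $x,y\in X$ with $x\succ y$. Complete: $x\succcurlyeq y$ or $y\succcurlyeq x$ for all $x,y\in X$. Demonstrates convex indifference: for all $x,y\in X$ and $\lambda\in(0,1)$, $x\sim y$ implies $x\sim x\lambda y$. Mixture-continuous: for all $x,y,z\in X$, the sets $\{\lambda\in[0,1]:x\lambda y\succcurlyeq z\}$ and $\{\lambda\in[0,1]:z\succcurlyeq x\lambda y\}$ are closed. Archimedean: for all $x,y,z\in X$ with $x\succ y$ there exist $\lambda,\delta\in(0,1)$ with $x\lambda z\succ y$ and $x\succ y\delta z$. Continuous: for all $x\in X$, the sets $\{y\in X:y\succcurlyeq x\}$ and $\{y\in X:x\succcurlyeq y\}$ are closed in $X$, and the sets $\{y\in X:y\succ x\}$ and $\{y\in X:x\succ y\}$ are open in $X$. *)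

theory Defs
  imports "HOL-Analysis.Analysis"
begin

text \<open>
  A binary relation on \<open>X\<close> is a predicate \<open>R\<close> whose values outside \<open>X\<close> are never consulted:
  every property below quantifies over \<open>X\<close> only. \<open>R x y\<close> is read as \<open>x \<succcurlyeq> y\<close>.
\<close>

definition strict_part :: "('a \<Rightarrow> 'a \<Rightarrow> bool) \<Rightarrow> 'a \<Rightarrow> 'a \<Rightarrow> bool" where
  "strict_part R x y \<longleftrightarrow> R x y \<and> \<not> R y x"

definition sym_part :: "('a \<Rightarrow> 'a \<Rightarrow> bool) \<Rightarrow> 'a \<Rightarrow> 'a \<Rightarrow> bool" where
  "sym_part R x y \<longleftrightarrow> R x y \<and> R y x"

text \<open>The weight \<open>l\<close> belongs to the first point.\<close>

definition mix :: "'a::real_vector \<Rightarrow> real \<Rightarrow> 'a \<Rightarrow> 'a" where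
  "mix x l y = l *\<^sub>R x + (1 - l) *\<^sub>R y"

definition nontrivial_on :: "'a set \<Rightarrow> ('a \<Rightarrow> 'a \<Rightarrow> bool) \<Rightarrow> bool" where
  "nontrivial_on X R \<longleftrightarrow> (\<exists>x\<in>X. \<exists>y\<in>X. strict_part R x y)"

text \<open>Unlike \<^const>\<open>totalp_on\<close>, completeness includes the case \<open>x = y\<close>.\<close>

definition complete_rel_on :: "'a set \<Rightarrow> ('a \<Rightarrow> 'a \<Rightarrow> bool) \<Rightarrow> bool" where
  "complete_rel_on X R \<longleftrightarrow> (\<forall>x\<in>X. \<forall>y\<in>X. R x y \<or> R y x)"

definition convex_indifference_on :: "'a::real_vector set \<Rightarrow> ('a \<Rightarrow> 'a \<Rightarrow> bool) \<Rightarrow> bool" where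
  "convex_indifference_on X R \<longleftrightarrow>
     (\<forall>x\<in>X. \<forall>y\<in>X. \<forall>l\<in>{0<..<1}. sym_part R x y \<longrightarrow> sym_part R x (mix x l y))"

definition mixture_continuous_on :: "'a::real_vector set \<Rightarrow> ('a \<Rightarrow> 'a \<Rightarrow> bool) \<Rightarrow> bool" where
  "mixture_continuous_on X R \<longleftrightarrow>
     (\<forall>x\<in>X. \<forall>y\<in>X. \<forall>z\<in>X.
        closed {l\<in>{0..1}. R (mix x l y) z} \<and> closed {l\<in>{0..1}. R z (mix x l y)})"

definition archimedean_on :: "'a::real_vector set \<Rightarrow> ('a \<Rightarrow> 'a \<Rightarrow> bool) \<Rightarrow> bool" where
  "archimedean_on X R \<longleftrightarrow>
     (\<forall>x\<in>X. \<forall>y\<in>X. \<forall>z\<in>X. strict_part R x y \<longrightarrow>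
        (\<exists>l\<in>{0<..<1}. \<exists>d\<in>{0<..<1}. strict_part R (mix x l z) y \<and> strict_part R x (mix y d z)))"

definition continuous_rel_on :: "'a::topological_space set \<Rightarrow> ('a \<Rightarrow> 'a \<Rightarrow> bool) \<Rightarrow> bool" where
  "continuous_rel_on X R \<longleftrightarrow>
     (\<forall>x\<in>X.
        closedin (top_of_set X) {y\<in>X. R y x} \<and>
        closedin (top_of_set X) {y\<in>X. R x y} \<and>
        openin (top_of_set X) {y\<in>X. strict_part R y x} \<and>
        openin (top_of_set X) {y\<in>X. strict_part R x y})"

end

theory Submission
  imports Defs
begin

text \<open>
  Fix \<open>z\<close>. Mixture continuity and the Archimedean property show that, along a segment, the
  relation to \<open>z\<close> can change only by passing through a point indifferent to \<open>z\<close>, while convex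
  indifference and transitivity of \<open>\<sim>\<close> make every indifference class convex. Consequently a
  strict comparison on a line makes the relation monotone along that line, and two points
  separated by the class of \<open>z\<close> stand in opposite relations to \<open>z\<close>. A single strict comparison
  therefore makes all points comparable and rules out cycles. The sections of the resulting
  preorder are convex. A point of \<open>X\<close> in the closure of a section is an endpoint of an open
  segment starting in the relative interior of the section and contained in it, so mixture
  continuity puts the point into the section.
\<close>

section \<open>Points on segments and their order\<close>

lemma mix_in_closed_segment:
  fixes x y :: "'a::real_vector"
  shows "l \<in> {0..1} \<Longrightarrow> mix x l y \<in> closed_segment x y"
  by (metis atLeastAtMost_iff closed_segment_commute in_segment(1) mix_def add.commute)

lemma mem_closed_segment_iff_mix:
  fixes x y :: "'a::real_vector"
  shows "p \<in> closed_segment x y \<longleftrightarrow> (\<exists>l\<in>{0..1}. p = mix x l y)"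
proof
  assume "p \<in> closed_segment x y"
  then have "p \<in> closed_segment y x"
    by (simp add: closed_segment_commute)
  then show "\<exists>l\<in>{0..1}. p = mix x l y"
    by (force simp: in_segment mix_def)
qed (auto simp: mix_in_closed_segment)

text \<open>The four points lie in the order \<open>x\<close>, \<open>p\<close>, \<open>q\<close>,
  \<open>y\<close>.\<close>

lemma closed_segment_exchange:
  fixes p q x y :: "'a::euclidean_space"
  assumes "p \<in> closed_segment x y" "q \<in> closed_segment p y"
  shows "p \<in> closed_segment x q"
  using between_trans_2[of y x p q] assms
  by (simp add: between_mem_segment closed_segment_commute)

lemma mix_mix_left: "mix (mix x m y) l y = mix x (l * m) y"
  by (simp add: mix_def algebra_simps)

section \<open>Strict preference and indifference along segments\<close>

locale convex_mixture_relation =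
  fixes X :: "'a::euclidean_space set" and R :: "'a \<Rightarrow> 'a \<Rightarrow> bool"
  assumes conv: "convex X"
    and refl: "reflp_on X R"
    and mixture_cont: "mixture_continuous_on X R"
    and arch: "archimedean_on X R"
    and convex_indiff: "convex_indifference_on X R"
    and trans_sym: "transp_on X (sym_part R)"
begin

abbreviation strict (infix "\<succ>" 50) where "x \<succ> y \<equiv> strict_part R x y"
abbreviation indiff (infix "\<sim>" 50) where "x \<sim> y \<equiv> sym_part R x y"

text \<open>Each assumption is invariant under reversing the relation, so every result of this
  context also yields its mirror image.\<close>

lemma dual: "convex_mixture_relation X (\<lambda>x y. R y x)"
proof
  show "archimedean_on X (\<lambda>x y. R y x)"
    using arch unfolding archimedean_on_def strict_part_def by blast
  show "convex_indifference_on X (\<lambda>x y. R y x)"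
    using convex_indiff unfolding convex_indifference_on_def sym_part_def by blast
  show "transp_on X (sym_part (\<lambda>x y. R y x))"
    using trans_sym unfolding transp_on_def sym_part_def by blast
  show "mixture_continuous_on X (\<lambda>x y. R y x)"
    using mixture_cont unfolding mixture_continuous_on_def by blast
  show "reflp_on X (\<lambda>x y. R y x)"
    using refl unfolding reflp_on_def by blast
qed (rule conv)

lemma strict_dual: "strict_part (\<lambda>x y. R y x) x y \<longleftrightarrow> y \<succ> x"
  by (simp add: strict_part_def)

lemma sym_dual: "sym_part (\<lambda>x y. R y x) x y \<longleftrightarrow> x \<sim> y"
  by (auto simp: sym_part_def)

lemma indiff_sym: "x \<sim> y \<Longrightarrow> y \<sim> x"
  by (simp add: sym_part_def)

lemma indiff_trans: "\<lbrakk>x \<in> X; y \<in> X; z \<in> X; x \<sim> y; y \<sim> z\<rbrakk> \<Longrightarrow> x \<sim> z"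
  using trans_sym by (blast dest: transp_onD)

lemma strict_imp_not_indiff: "x \<succ> y \<Longrightarrow> \<not> x \<sim> y" "x \<succ> y \<Longrightarrow> \<not> y \<sim> x"
  by (auto simp: strict_part_def sym_part_def)

lemma segment_in_X: "\<lbrakk>x \<in> X; y \<in> X; p \<in> closed_segment x y\<rbrakk> \<Longrightarrow> p \<in> X"
  using closed_segment_subset[OF _ _ conv] by blast

lemma indiff_segment:
  assumes "x \<in> X" "y \<in> X" "x \<sim> y" "p \<in> closed_segment x y"
  shows "x \<sim> p"
proof -
  obtain l where l: "l \<in> {0..1}" "p = mix x l y"
    using assms(4) by (auto simp: mem_closed_segment_iff_mix)
  consider "l = 0" | "l = 1" | "l \<in> {0<..<1}"
    using l(1) by fastforce
  then show ?thesis
  proof cases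
    case 1
    then show ?thesis using l assms by (simp add: mix_def)
  next
    case 2
    then show ?thesis using l assms refl by (simp add: mix_def sym_part_def reflp_on_def)
  next
    case 3
    then show ?thesis
      using convex_indiff assms l unfolding convex_indifference_on_def by blast
  qed
qed

text \<open>
  Otherwise take the parameter farthest from \<open>x\<close> at which the point is still weakly above \<open>z\<close>;
  it is strictly above, so the Archimedean property moves it further.
\<close>
lemma strict_along_segment:
  assumes X: "x \<in> X" "y \<in> X" "z \<in> X" and "x \<succ> z"
    and none: "\<And>p. p \<in> closed_segment x y \<Longrightarrow> \<not> p \<sim> z"
  shows "y \<succ> z"
proof -
  define S where "S = {l \<in> {0..1}. R (mix x l y) z}"
  define m where "m = Inf S"
  have "closed S"
    using mixture_cont X unfolding mixture_continuous_on_def S_def by blast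
  moreover have "1 \<in> S"
    using \<open>x \<succ> z\<close> by (simp add: S_def mix_def strict_part_def)
  moreover have bdd: "bdd_below S"
    by (rule bdd_belowI[of _ 0]) (simp add: S_def)
  ultimately have "m \<in> S"
    unfolding m_def by (metis closed_contains_Inf empty_iff)
  then have m01: "m \<in> {0..1}" and Rm: "R (mix x m y) z"
    by (auto simp: S_def)
  have seg: "mix x m y \<in> closed_segment x y"
    using m01 by (rule mix_in_closed_segment)
  then have strict_m: "mix x m y \<succ> z"
    using none[OF seg] Rm by (auto simp: strict_part_def sym_part_def)
  have "m = 0"
  proof (rule ccontr)
    assume "m \<noteq> 0"
    obtain l where l: "l \<in> {0<..<1}" "mix (mix x m y) l y \<succ> z"
      using arch strict_m segment_in_X[OF X(1,2) seg] X(2,3)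
      unfolding archimedean_on_def by blast
    have "l * m < m"
      using l(1) m01 \<open>m \<noteq> 0\<close> by simp
    moreover have "l * m \<in> S"
      using l m01 \<open>l * m < m\<close> by (auto simp: S_def mix_mix_left strict_part_def)
    ultimately show False
      using cInf_lower[OF _ bdd, of "l * m"] by (simp add: m_def)
  qed
  then show ?thesis
    using strict_m by (simp add: mix_def)
qed

lemma strict_along_segment_dual:
  assumes "x \<in> X" "y \<in> X" "z \<in> X" "z \<succ> x"
    and "\<And>p. p \<in> closed_segment x y \<Longrightarrow> \<not> p \<sim> z"
  shows "z \<succ> y"
  using convex_mixture_relation.strict_along_segment[OF dual, of x y z] assms
  by (simp add: strict_dual sym_dual)

text \<open>The whole segment from \<open>y\<close> to \<open>z\<close> is indifferent to
  \<open>y\<close>, whereas \<open>x\<close> is not. So no point of it is indifferent to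
  \<open>x\<close>, and strictness passes from \<open>y\<close> to \<open>z\<close>.\<close>

lemma strict_indiff_trans:
  assumes X: "x \<in> X" "y \<in> X" "z \<in> X" and "x \<succ> y" "y \<sim> z"
  shows "x \<succ> z"
proof (rule strict_along_segment_dual[OF X(2,3,1) \<open>x \<succ> y\<close>])
  fix p assume p: "p \<in> closed_segment y z"
  have "y \<sim> p"
    using indiff_segment[OF X(2,3) \<open>y \<sim> z\<close> p] .
  then show "\<not> p \<sim> x"
    using indiff_trans[OF X(2) segment_in_X[OF X(2,3) p] X(1)] \<open>x \<succ> y\<close>
      strict_imp_not_indiff by blast
qed

lemma indiff_strict_trans:
  assumes "x \<in> X" "y \<in> X" "z \<in> X" "x \<sim> y" "y \<succ> z"
  shows "x \<succ> z"
  using convex_mixture_relation.strict_indiff_trans[OF dual, of z y x] assms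
  by (simp add: strict_dual sym_dual indiff_sym)

text \<open>A point \<open>q\<close> beyond \<open>p\<close> indifferent to \<open>x\<close> would
  make \<open>p\<close>, which lies between \<open>x\<close> and \<open>q\<close>, indifferent to
  \<open>x\<close> too. Hence strictness passes from \<open>p\<close> to \<open>y\<close>.\<close>

lemma strict_extend:
  assumes X: "x \<in> X" "y \<in> X" and p: "p \<in> closed_segment x y" and "x \<succ> p"
  shows "x \<succ> y"
proof (rule strict_along_segment_dual[OF segment_in_X[OF X p] X(2,1) \<open>x \<succ> p\<close>])
  fix q assume q: "q \<in> closed_segment p y"
  then have "q \<in> X"
    using segment_in_X X p by blast
  moreover have "p \<in> closed_segment x q"
    using p q by (rule closed_segment_exchange)
  ultimately show "\<not> q \<sim> x"
    using indiff_segment[OF X(1)] \<open>x \<succ> p\<close> strict_imp_not_indiff indiff_sym by blast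
qed

lemma strict_extend_dual:
  assumes "x \<in> X" "y \<in> X" "p \<in> closed_segment x y" "p \<succ> x"
  shows "y \<succ> x"
  using convex_mixture_relation.strict_extend[OF dual, of x y p] assms
  by (simp add: strict_dual)

lemma strict_opposite:
  assumes X: "x \<in> X" "y \<in> X" "z \<in> X" and p: "p \<in> closed_segment x y"
    and "p \<sim> z" "x \<succ> z" "\<not> y \<sim> z"
  shows "z \<succ> y"
proof -
  have pX: "p \<in> X"
    using segment_in_X X p by blast
  have "x \<succ> p"
    using strict_indiff_trans X pX \<open>x \<succ> z\<close> \<open>p \<sim> z\<close> indiff_sym by blast
  then have "x \<succ> y"
    using strict_extend X p by blast
  \<comment> \<open>If some \<open>q\<close> between \<open>x\<close> and \<open>p\<close> were
    indifferent to \<open>y\<close>, then so would be \<open>p\<close>, which lies between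
    \<open>y\<close> and \<open>q\<close>. This would give \<open>y \<sim> z\<close>.\<close>
  have "p \<succ> y"
  proof (rule strict_along_segment[OF X(1) pX X(2) \<open>x \<succ> y\<close>])
    fix q assume q: "q \<in> closed_segment x p"
    then have qX: "q \<in> X"
      using segment_in_X X pX by blast
    have "p \<in> closed_segment y q"
      using closed_segment_exchange[of p y x q] p q by (simp add: closed_segment_commute)
    then show "\<not> q \<sim> y"
      using indiff_segment[OF X(2) qX] indiff_trans[OF X(2) pX X(3)]
        \<open>p \<sim> z\<close> \<open>\<not> y \<sim> z\<close> indiff_sym by blast
  qed
  then show ?thesis
    using indiff_strict_trans X pX \<open>p \<sim> z\<close> indiff_sym by blast
qed

text \<open>If the segment from \<open>x\<close> to \<open>v\<close> meets the indifference class of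
  \<open>z\<close>, then \<open>v\<close> is in that class or on the side opposite to
  \<open>x\<close>; if not, \<open>v\<close> is on the side of \<open>x\<close>.\<close>

lemma comparable_of_strict:
  assumes X: "x \<in> X" "z \<in> X" "v \<in> X" and "x \<succ> z"
  shows "R v z \<or> R z v"
proof (cases "\<exists>p\<in>closed_segment x v. p \<sim> z")
  case True
  then show ?thesis
    using strict_opposite X \<open>x \<succ> z\<close> unfolding strict_part_def sym_part_def by metis
next
  case False
  then show ?thesis
    using strict_along_segment[of x v z] X \<open>x \<succ> z\<close> by (auto simp: strict_part_def)
qed

lemma comparable_of_strict_dual:
  assumes "x \<in> X" "z \<in> X" "v \<in> X" "z \<succ> x"
  shows "R v z \<or> R z v"
  using convex_mixture_relation.comparable_of_strict[OF dual, of x z v] assms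
  by (auto simp: strict_dual)

end

section \<open>Completeness, transitivity and continuity\<close>

locale nontrivial_convex_mixture_relation = convex_mixture_relation +
  assumes nontrivial: "nontrivial_on X R"
begin

lemma nontrivial_dual: "nontrivial_convex_mixture_relation X (\<lambda>x y. R y x)"
  using dual nontrivial
  unfolding nontrivial_convex_mixture_relation_def nontrivial_convex_mixture_relation_axioms_def
    nontrivial_on_def strict_dual by blast

text \<open>A fixed strict pair makes \<open>b\<close> comparable with \<open>x\<close>. Each
  outcome provides a strict comparison involving \<open>b\<close>, which in turn makes
  \<open>a\<close> comparable with \<open>b\<close>.\<close>

lemma complete:
  assumes "a \<in> X" "b \<in> X"
  shows "R a b \<or> R b a"
proof -
  obtain x y where xy: "x \<in> X" "y \<in> X" "x \<succ> y"
    using nontrivial unfolding nontrivial_on_def by blast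
  consider "b \<sim> x" | "x \<succ> b" | "b \<succ> x"
    using comparable_of_strict_dual[of y x b] xy assms by (auto simp: strict_part_def sym_part_def)
  then show ?thesis
  proof cases
    case 1
    then have "b \<succ> y"
      using indiff_strict_trans xy assms by blast
    then show ?thesis
      using comparable_of_strict_dual xy assms by blast
  next
    case 2
    then show ?thesis using comparable_of_strict xy assms by blast
  next
    case 3
    then show ?thesis using comparable_of_strict_dual xy assms by blast
  qed
qed

lemma not_R_iff: "\<lbrakk>x \<in> X; y \<in> X\<rbrakk> \<Longrightarrow> \<not> R x y \<longleftrightarrow> y \<succ> x"
  using complete by (auto simp: strict_part_def)

lemma trans:
  assumes X: "x \<in> X" "y \<in> X" "z \<in> X" and R: "R x y" "R y z"
  shows "R x z"
proof (rule ccontr)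
  assume "\<not> R x z"
  then have "z \<succ> x"
    using not_R_iff X by blast
  have "\<not> x \<sim> y"
    using strict_indiff_trans[OF X(3,1,2) \<open>z \<succ> x\<close>] R(2) by (auto simp: strict_part_def)
  then have "x \<succ> y"
    using R by (auto simp: strict_part_def sym_part_def)
  \<comment> \<open>Without such a point, \<open>x \<succ> y\<close> would carry over to
    \<open>z \<succ> y\<close>, against \<open>R y z\<close>.\<close>
  then obtain p where p: "p \<in> closed_segment x z" "p \<sim> y"
    using strict_along_segment[OF X(1,3,2)] R(2) by (auto simp: strict_part_def)
  have "x \<succ> p"
    using strict_indiff_trans[OF X(1,2) _ \<open>x \<succ> y\<close>] segment_in_X[OF X(1,3) p(1)] p(2) indiff_sym
    by blast
  then have "x \<succ> z"
    using strict_extend X p by blast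
  then show False
    using \<open>\<not> R x z\<close> by (simp add: strict_part_def)
qed

text \<open>If \<open>z \<succ> p\<close> between \<open>a\<close> and \<open>b\<close>, the way
  from \<open>p\<close> to \<open>a\<close> meets the class of \<open>z\<close> at some
  \<open>q\<close> with \<open>q \<succ> p\<close>. Continuing past \<open>p\<close> gives
  \<open>q \<succ> b\<close>, although \<open>b\<close> is weakly above \<open>z\<close> and
  \<open>z \<sim> q\<close>.\<close>

lemma convex_upper:
  assumes z: "z \<in> X"
  shows "convex {y \<in> X. R y z}"
  unfolding convex_contains_segment
proof (intro ballI subsetI)
  fix a b p
  assume "a \<in> {y \<in> X. R y z}" "b \<in> {y \<in> X. R y z}" and p: "p \<in> closed_segment a b"
  then have a: "a \<in> X" "R a z" and b: "b \<in> X" "R b z"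
    by auto
  have pX: "p \<in> X"
    using segment_in_X a b p by blast
  moreover have "R p z"
  proof (rule ccontr)
    assume "\<not> R p z"
    then have "z \<succ> p"
      using not_R_iff pX z by blast
    then obtain q where q: "q \<in> closed_segment p a" "q \<sim> z"
      using strict_along_segment_dual[OF pX a(1) z] a(2) by (auto simp: strict_part_def)
    have qX: "q \<in> X"
      using segment_in_X a(1) pX q(1) by blast
    have "p \<in> closed_segment q b"
      using closed_segment_exchange[of p b a q] p q(1) by (simp add: closed_segment_commute)
    moreover have "q \<succ> p"
      using indiff_strict_trans[OF qX z pX q(2) \<open>z \<succ> p\<close>] .
    ultimately have "q \<succ> b"
      using strict_extend qX b(1) by blast
    moreover have "R b q"
      using trans[OF b(1) z qX b(2)] q(2) by (simp add: sym_part_def)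
    ultimately show False
      by (simp add: strict_part_def)
  qed
  ultimately show "p \<in> {y \<in> X. R y z}"
    by simp
qed

lemma closedin_upper:
  assumes z: "z \<in> X"
  shows "closedin (top_of_set X) {y \<in> X. R y z}"
proof -
  define C where "C = {y \<in> X. R y z}"
  have "convex C"
    unfolding C_def using z by (rule convex_upper)
  \<comment> \<open>A nonempty convex set in finite dimension has nonempty relative
    interior.\<close>
  have "z \<in> C"
    using refl z by (simp add: C_def reflp_on_def)
  then obtain q where q: "q \<in> rel_interior C"
    using rel_interior_eq_empty[OF \<open>convex C\<close>] by blast
  have qX: "q \<in> X"
    using q rel_interior_subset C_def by blast
  have "p \<in> C" if pX: "p \<in> X" and "p \<in> closure C" for p
  proof -
    define S where "S = {l \<in> {0..1}. R (mix q l p) z}"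
    have "closed S"
      using mixture_cont qX pX z unfolding mixture_continuous_on_def S_def by blast
    have "{0<..<1} \<subseteq> S"
    proof
      fix l :: real assume l: "l \<in> {0<..<1}"
      \<comment> \<open>Any positive weight on \<open>q\<close> moves the closure point
        \<open>p\<close> into the relative interior.\<close>
      have "p - l *\<^sub>R (p - q) \<in> rel_interior C"
        using rel_interior_closure_convex_shrink[OF \<open>convex C\<close> q \<open>p \<in> closure C\<close>, of l] l by simp
      moreover have "p - l *\<^sub>R (p - q) = mix q l p"
        by (simp add: mix_def algebra_simps)
      ultimately have "mix q l p \<in> C"
        using rel_interior_subset by (metis subsetD)
      then show "l \<in> S"
        using l by (simp add: S_def C_def)
    qed
    then have "closure {0<..<1} \<subseteq> S"
      using \<open>closed S\<close> by (rule closure_minimal)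
    \<comment> \<open>Weight 0 is the point \<open>p\<close> itself.\<close>
    then have "0 \<in> S"
      by auto
    then show ?thesis
      using pX by (simp add: S_def C_def mix_def)
  qed
  then have "C = X \<inter> closure C"
    using closure_subset[of C] by (auto simp: C_def)
  then show ?thesis
    unfolding C_def by (metis closed_closure closedin_closed)
qed

lemma openin_strict_lower:
  assumes z: "z \<in> X"
  shows "openin (top_of_set X) {y \<in> X. z \<succ> y}"
proof -
  have "{y \<in> X. z \<succ> y} = X - {y \<in> X. R y z}"
    using not_R_iff z by blast
  then show ?thesis
    using closedin_upper[OF z] by (simp add: closedin_def)
qed

text \<open>The two remaining kinds of sections are the same sets for the reversed relation.\<close>

lemma continuous_rel: "continuous_rel_on X R"
  unfolding continuous_rel_on_def
  using closedin_upper openin_strict_lower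
    nontrivial_convex_mixture_relation.closedin_upper[OF nontrivial_dual]
    nontrivial_convex_mixture_relation.openin_strict_lower[OF nontrivial_dual]
  by (simp add: strict_dual)

end

theorem proposition8:
  fixes X :: "(real ^ 'n) set"
    and R :: "real ^ 'n \<Rightarrow> real ^ 'n \<Rightarrow> bool"
  assumes "convex X"
    and "open X \<or> polyhedron X"
    and "nontrivial_on X R"
    and "reflp_on X R"
    and "mixture_continuous_on X R"
    and "archimedean_on X R"
    and "convex_indifference_on X R"
    and "transp_on X (sym_part R)"
  shows "continuous_rel_on X R \<and> complete_rel_on X R \<and> transp_on X R"
proof -
  interpret nontrivial_convex_mixture_relation X R
    using assms by unfold_locales
  show ?thesis
    using continuous_rel complete trans
    unfolding complete_rel_on_def transp_on_def by blast
qed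

end
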